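(* Let $\mathbf{X}=A\mathbf{Z}+\mathbf{E}$ be the linear factor model described in the context, with $A\in[0,\infty)^{d\times K}$ satisfying: (i) $\sum_{a=1}^K A_{ja}=1$ for every $j\in[d]$; (ii) for every $a\in[K]$ there is at least one index $j\in[d]$ with $A_{ja}=1$ and $A_{jb}=0$ for all $b\neq a$. Let $\mathcal{X}=[\chi(i,j)]_{i,j\in[d]}$ be the extremal correlation matrix of $\mathbf{X}$. Then: (a) The set $[K]$ of latent factors is given by any maximum clique of the undirected graph $G=(V,E)$ with $V=[d]$ and $(i,j)\in E$ if $\chi(i,j)=0$; that is, every maximum clique of $G$ has the form $\{i_1,\dots,i_K\}$ with $i_a\in I_a$ for each $a\in[K]$ (exactly one pure variable per latent factor). (b) Let $a\in[K]$ with $|I_a|\ge 2$ and $i\in I_a$. Then, for any $j\in S_i$, $j\in I_a\iff\chi(i,j)=1$. (c) The pure variable set $I$ is uniquely determined by $\mathcal{X}$, and its partition $\mathcal{I}=\{I_a\}_{1\le a\le K}$ is unique and determined by $\mathcal{X}$ up to label permutations. That is, if $A$ (of size $d\times K$) and $A'$ (of size $d\times K'$) both satisfy (i) and (ii) and give rise, through the model, to the same extremal correlation matrix, then they have the same pure variable set and the same (unlabelled) partition of it.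
   Context: Notation: $[d]=\{1,\dots,d\}$, $[K]=\{1,\dots,K\}$. Linear factor model: $\mathbf{X}=A\mathbf{Z}+\mathbf{E}$ is $\mathbb{R}^d$-valued, $A\in[0,\infty)^{d\times K}$ deterministic. $\mathbf{Z}=(Z^{(1)},\dots,Z^{(K)})$ is a nonnegative random vector, regularly varying with tail index $1$ and asymptotically independent components: for some scaling sequence $(c_n)$, $n\mathbb{P}\{c_n^{-1}\mathbf{Z}\in\cdot\}\to\Lambda_{\mathbf{Z}}$ vaguely on $[0,\infty)^K\setminus\{0\}$, where $\Lambda_{\mathbf{Z}}=\sum_{k=1}^K\delta_0\otimes\dots\otimes\Lambda_{Z^{(k)}}\otimes\dots\otimes\delta_0$ and $\Lambda_{Z^{(k)}}(dy)=y^{-2}dy$ on $(0,\infty)$. The noise $\mathbf{E}$ has a lighter tail: $\lim_{x\to\infty}\mathbb{P}\{\|\mathbf{E}\|>x\}/\mathbb{P}\{\|\mathbf{Z}\|>x\}=0$. Extremal correlation: $\chi(i,j)=\lim_{x\to\infty}\mathbb{P}\{X^{(i)}>x,X^{(j)}>x\}/\mathbb{P}\{X^{(j)}>x\}$ (the limit exists in this model). Pure variables: $I_a=\{i\in[d]:A_{ia}=1,\ A_{ib}=0\ \forall b\ne a\}$ and $I=I(A)=\bigcup_{a=1}^K I_a$; the sets $I_a$ partition $I$. For $i\in[d]$: $M_i=\max_{j\in[d]\setminus\{i\}}\chi(i,j)$ and $S_i=\{j\in[d]\setminus\{i\}:\chi(i,j)=M_i\}$. Graphs are simple (edges join distinct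 vertices); a clique is a set of pairwise adjacent vertices, and a maximum clique is a clique of largest cardinality. *)

theory Defs
  imports "HOL-Probability.Probability" "HOL-Library.Ramsey"
begin

section \<open>Regular variation with asymptotically independent components\<close>

text \<open>
  The measure \<open>y\<^sup>-\<^sup>2 dy\<close> on \<open>(0,\<infinity>)\<close>, regarded as a Borel measure on the line.
\<close>

definition pareto_measure :: "real measure" where
  "pareto_measure = density lborel (\<lambda>y. ennreal (indicator {0<..} y / y\<^sup>2))"

text \<open>
  The product of \<open>pareto_measure\<close> in coordinate \<open>k\<close> with the point masses at 0 in all other
  coordinates is the image of \<open>pareto_measure\<close> under the embedding of the line as the
  \<open>k\<close>-th coordinate axis; see \<open>emeasure_axis_measure_rectangle\<close> below.
\<close>

definition axis_measure :: "'k::finite \<Rightarrow> (real ^ 'k) measure" where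
  "axis_measure k = distr pareto_measure borel (axis k)"

definition indep_exponent_measure :: "(real ^ 'k::finite) measure" where
  "indep_exponent_measure =
     measure_of UNIV (sets borel) (\<lambda>B. \<Sum>k\<in>UNIV. emeasure (axis_measure k) B)"

lemma measurable_axis: "axis k \<in> borel_measurable (borel :: real measure)"
  for k :: "'k::finite"
proof (rule borel_measurable_continuous_onI)
  have "continuous_on UNIV (\<lambda>x. if i = k then x else (0::real))" for i
    by (cases "i = k") auto
  then show "continuous_on UNIV (axis k :: real \<Rightarrow> real ^ 'k)"
    unfolding axis_def by (intro continuous_on_vec_lambda)
qed

lemma emeasure_axis_measure_rectangle:
  fixes B :: "'k::finite \<Rightarrow> real set"
  assumes "\<And>l. B l \<in> sets borel"
  shows "emeasure (axis_measure k) {z. \<forall>l. z $ l \<in> B l} =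
     emeasure pareto_measure (B k) * (\<Prod>l\<in>UNIV - {k}. indicator (B l) 0)"
proof -
  have "(\<lambda>z :: real ^ 'k. z $ l) -` B l \<inter> space borel \<in> sets borel" for l
    by (rule measurable_sets[OF _ assms]) auto
  then have "(\<Inter>l. (\<lambda>z :: real ^ 'k. z $ l) -` B l) \<in> sets borel"
    by (intro sets.countable_INT) (auto simp: countable_finite)
  moreover have "(\<Inter>l. (\<lambda>z :: real ^ 'k. z $ l) -` B l) = {z. \<forall>l. z $ l \<in> B l}"
    by auto
  ultimately have meas: "{z. \<forall>l. z $ l \<in> B l} \<in> sets (borel :: (real ^ 'k) measure)"
    by simp
  have sp: "space pareto_measure = UNIV"
    by (simp add: pareto_measure_def)
  have "emeasure (axis_measure k) {z. \<forall>l. z $ l \<in> B l} =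
      emeasure pareto_measure (axis k -` {z. \<forall>l. z $ l \<in> B l})"
    unfolding axis_measure_def using meas measurable_axis[of k]
    by (subst emeasure_distr) (auto simp: sp pareto_measure_def)
  also have "axis k -` {z. \<forall>l. z $ l \<in> B l} = (if \<forall>l\<in>UNIV - {k}. 0 \<in> B l then B k else {})"
    by (auto simp: axis_def)
  also have "emeasure pareto_measure \<dots> =
      emeasure pareto_measure (B k) * (\<Prod>l\<in>UNIV - {k}. indicator (B l) 0)"
    by (auto simp: indicator_def intro!: prod.neutral)
  finally show ?thesis .
qed

lemma sets_indep_exponent_measure [simp, measurable_cong]:
  "sets (indep_exponent_measure :: (real ^ 'k::finite) measure) = sets borel"
  unfolding indep_exponent_measure_def
  using sets.sets_measure_of_eq[of "borel :: (real ^ 'k) measure"] by simp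

lemma emeasure_indep_exponent_measure:
  assumes "B \<in> sets borel"
  shows "emeasure indep_exponent_measure B =
    (\<Sum>k\<in>UNIV. emeasure (axis_measure (k :: 'k::finite)) B)"
proof (rule emeasure_measure_of[OF indep_exponent_measure_def])
  let ?S = "sets (indep_exponent_measure :: (real ^ 'k) measure)"
  show "positive ?S (\<lambda>B. \<Sum>k\<in>UNIV. emeasure (axis_measure (k :: 'k)) B)"
    by (simp add: positive_def)
  show "countably_additive ?S (\<lambda>B. \<Sum>k\<in>UNIV. emeasure (axis_measure (k :: 'k)) B)"
  proof (rule countably_additiveI)
    fix F :: "nat \<Rightarrow> (real ^ 'k) set"
    assume F: "range F \<subseteq> ?S" "disjoint_family F"
    have "(\<Sum>i. \<Sum>k\<in>UNIV. emeasure (axis_measure k) (F i)) =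
        (\<Sum>k\<in>UNIV. \<Sum>i. emeasure (axis_measure k) (F i))"
      by (rule suminf_sum) simp
    also have "\<dots> = (\<Sum>k\<in>UNIV. emeasure (axis_measure k) (\<Union> (range F)))"
      using F by (intro sum.cong refl suminf_emeasure) (auto simp: axis_measure_def)
    finally show "(\<Sum>i. \<Sum>k\<in>UNIV. emeasure (axis_measure k) (F i)) =
        (\<Sum>k\<in>UNIV. emeasure (axis_measure k) (\<Union> (range F)))" .
  qed
qed (use assms in auto)

definition nonneg_orthant :: "(real ^ 'k::finite) set" where
  "nonneg_orthant = {z. \<forall>k. 0 \<le> z $ k}"

text \<open>
  Vague convergence on \<open>S - {0}\<close>, where the bounded sets are those bounded away from the origin:
  the test functions are bounded, continuous and vanish near 0. They need not vanish near
  infinity, so no mass may escape to infinity.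
\<close>

definition vague_conv_away_from_zero ::
    "'a::real_normed_vector set \<Rightarrow> (nat \<Rightarrow> 'a measure) \<Rightarrow> 'a measure \<Rightarrow> bool" where
  "vague_conv_away_from_zero S \<mu> \<nu> \<longleftrightarrow>
     (\<forall>f :: 'a \<Rightarrow> real.
        continuous_on (S - {0}) f \<and> (\<forall>z\<in>S - {0}. 0 \<le> f z) \<and> bounded (f ` (S - {0})) \<and>
        (\<exists>r>0. \<forall>z\<in>S - {0}. norm z < r \<longrightarrow> f z = 0) \<longrightarrow>
        (\<lambda>n. \<integral>\<^sup>+z\<in>S - {0}. ennreal (f z) \<partial>\<mu> n) \<longlonglongrightarrow> (\<integral>\<^sup>+z\<in>S - {0}. ennreal (f z) \<partial>\<nu>))"

definition reg_var_indep :: "'w measure \<Rightarrow> ('w \<Rightarrow> real ^ 'k::finite) \<Rightarrow> bool" where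
  "reg_var_indep M Z \<longleftrightarrow>
     (\<exists>c :: nat \<Rightarrow> real. (\<forall>n. 0 < c n) \<and>
        vague_conv_away_from_zero nonneg_orthant
          (\<lambda>n. scale_measure (of_nat n) (distr M borel (\<lambda>\<omega>. inverse (c n) *\<^sub>R Z \<omega>)))
          indep_exponent_measure)"

section \<open>The linear factor model and its extremal correlations\<close>

locale linear_factor_model = prob_space M
  for M :: "'w measure" +
  fixes A :: "real ^ 'k::finite ^ 'd::finite"
    and Z :: "'w \<Rightarrow> real ^ 'k"
    and E :: "'w \<Rightarrow> real ^ 'd"
    and X :: "'w \<Rightarrow> real ^ 'd"
  assumes A_nonneg: "0 \<le> A $ i $ a"
    and Z_measurable: "Z \<in> borel_measurable M"
    and E_measurable: "E \<in> borel_measurable M"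
    and Z_nonneg: "AE \<omega> in M. Z \<omega> \<in> nonneg_orthant"
    and Z_reg_var: "reg_var_indep M Z"
    and E_lighter_tail:
      "((\<lambda>x. prob {\<omega> \<in> space M. norm (E \<omega>) > x} / prob {\<omega> \<in> space M. norm (Z \<omega>) > x})
         \<longlongrightarrow> 0) at_top"
    and X_eq: "\<omega> \<in> space M \<Longrightarrow> X \<omega> = A *v Z \<omega> + E \<omega>"

definition extremal_corr :: "'w measure \<Rightarrow> ('w \<Rightarrow> real ^ 'd::finite) \<Rightarrow> real ^ 'd ^ 'd" where
  "extremal_corr M X = (\<chi> i j. Lim at_top (\<lambda>x::real.
     measure M {\<omega> \<in> space M. X \<omega> $ i > x \<and> X \<omega> $ j > x} / measure M {\<omega> \<in> space M. X \<omega> $ j > x}))"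

definition pure_vars_of :: "real ^ 'k::finite ^ 'd::finite \<Rightarrow> 'k \<Rightarrow> 'd set" where
  "pure_vars_of A a = {i. A $ i $ a = 1 \<and> (\<forall>b. b \<noteq> a \<longrightarrow> A $ i $ b = 0)}"

definition pure_vars :: "real ^ 'k::finite ^ 'd::finite \<Rightarrow> 'd set" where
  "pure_vars A = (\<Union>a. pure_vars_of A a)"

definition max_corr :: "real ^ 'd::finite ^ 'd \<Rightarrow> 'd \<Rightarrow> real" where
  "max_corr \<X> i = Max ((\<lambda>j. \<X> $ i $ j) ` (UNIV - {i}))"

definition max_corr_set :: "real ^ 'd::finite ^ 'd \<Rightarrow> 'd \<Rightarrow> 'd set" where
  "max_corr_set \<X> i = {j \<in> UNIV - {i}. \<X> $ i $ j = max_corr \<X> i}"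

section \<open>Maximum cliques\<close>

definition zero_corr_edges :: "real ^ 'd::finite ^ 'd \<Rightarrow> 'd set set" where
  "zero_corr_edges \<X> = {{i, j} | i j. i \<noteq> j \<and> \<X> $ i $ j = 0}"

text \<open>
  The constant \<open>clique\<close> is the one from \<open>HOL-Library.Ramsey\<close>; it does not
  require the clique to be contained in the vertex set.
\<close>

definition maximum_clique :: "'v set \<Rightarrow> 'v set set \<Rightarrow> 'v set \<Rightarrow> bool" where
  "maximum_clique V E C \<longleftrightarrow>
     C \<subseteq> V \<and> clique C E \<and> (\<forall>D. D \<subseteq> V \<and> clique D E \<longrightarrow> card D \<le> card C)"

end

theory Submission
  imports Defs
begin

text \<open>
  For a continuous functional \<open>g\<close>, homogeneous of degree 1 and nonnegative on the orthant, the
  exponent measure of \<open>{g > t}\<close> is \<open>(\<Sum>k. g e\<^sub>k) / t\<close>, so \<open>P(g(Z) > x) / P(\<parallel>Z\<parallel> > x)\<close> tends to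
  \<open>(\<Sum>k. g e\<^sub>k) / K\<close>, and a noise of lighter tail does not affect the limit. Taking for \<open>g\<close> the
  minimum of two coordinates of \<open>A z\<close> gives \<open>\<chi>(i,j) = \<Sum>a. min A\<^sub>i\<^sub>a A\<^sub>j\<^sub>a\<close>. Hence \<open>\<chi>(i,j) = 0\<close> iff the
  rows \<open>i\<close> and \<open>j\<close> of \<open>A\<close> have disjoint supports, and \<open>\<chi>(i,j) = 1\<close> iff these rows coincide. A clique
  is a family of rows with disjoint nonempty supports in \<open>[K]\<close>: it has at most \<open>K\<close> elements, and if
  it has \<open>K\<close>, all supports are singletons. So the pure variables are the members of the
  maximum cliques, and the blocks of their partition are the sets \<open>{j. \<chi>(i,j) = 1}\<close>.
\<close>


section \<open>Exponent measure of homogeneous functionals\<close>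

text \<open>Nonnegativity is asked on the orthant only, so that the minimum of two coordinates of a
  nonnegative matrix times \<open>z\<close> qualifies. Homogeneity includes \<open>r = 0\<close>,
  which forces \<open>g 0 = 0\<close>.\<close>

definition orthant_functional :: "(real ^ 'k::finite \<Rightarrow> real) \<Rightarrow> bool" where
  "orthant_functional g \<longleftrightarrow>
     continuous_on UNIV g \<and> (\<forall>r\<ge>0. \<forall>z. g (r *\<^sub>R z) = r * g z) \<and>
     (\<forall>z\<in>nonneg_orthant. 0 \<le> g z)"

text \<open>This is the exponent measure of the part of the orthant where \<open>g\<close> is at
  least 1.\<close>

definition axis_sum :: "(real ^ 'k::finite \<Rightarrow> real) \<Rightarrow> real" where
  "axis_sum g = (\<Sum>k\<in>UNIV. g (axis k 1))"

lemma orthant_functionalD: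
  assumes "orthant_functional g"
  shows "continuous_on UNIV g" "r \<ge> 0 \<Longrightarrow> g (r *\<^sub>R z) = r * g z" "g 0 = 0"
    "z \<in> nonneg_orthant \<Longrightarrow> 0 \<le> g z" "g \<in> borel_measurable borel"
proof -
  show *: "continuous_on UNIV g" "r \<ge> 0 \<Longrightarrow> g (r *\<^sub>R z) = r * g z"
    "z \<in> nonneg_orthant \<Longrightarrow> 0 \<le> g z"
    using assms unfolding orthant_functional_def by blast+
  show "g \<in> borel_measurable borel"
    by (rule borel_measurable_continuous_onI[OF *(1)])
  have "g (0 *\<^sub>R 0) = 0 * g 0"
    using assms unfolding orthant_functional_def by blast
  then show "g 0 = 0" by simp
qed

lemma axis_in_nonneg_orthant: "0 \<le> y \<Longrightarrow> axis k y \<in> nonneg_orthant"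
  by (auto simp: nonneg_orthant_def axis_def)

lemma axis_sum_nonneg:
  assumes "orthant_functional g"
  shows "0 \<le> axis_sum g"
  unfolding axis_sum_def
  by (intro sum_nonneg orthant_functionalD(4)[OF assms] axis_in_nonneg_orthant) simp

lemma orthant_functional_norm: "orthant_functional (norm :: real ^ 'k::finite \<Rightarrow> real)"
  by (auto simp: orthant_functional_def intro: continuous_intros)

lemma axis_sum_norm: "axis_sum (norm :: real ^ 'k::finite \<Rightarrow> real) = CARD('k)"
  by (simp add: axis_sum_def norm_axis_1)

lemma orthant_functional_scale:
  "orthant_functional g \<Longrightarrow> 0 \<le> s \<Longrightarrow> orthant_functional (\<lambda>z. s * g z)"
  by (auto simp: orthant_functional_def intro: continuous_intros)

lemma axis_sum_scale: "axis_sum (\<lambda>z. s * g z) = s * axis_sum g"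
  by (simp add: axis_sum_def sum_distrib_left)

text \<open>For \<open>c > 0\<close> the set is the half-line from \<open>t / c\<close>, whose mass
  comes from the antiderivative \<open>- (1 / y)\<close> of the density; for \<open>c = 0\<close> it
  is empty.\<close>

lemma emeasure_pareto_measure_superlevel:
  assumes "t > 0" "c \<ge> 0"
  shows "emeasure pareto_measure {y. 0 < y \<and> t \<le> y * c} = ennreal (c / t)"
proof (cases "c = 0")
  case True
  then have empty: "{y. 0 < y \<and> t \<le> y * c} = {}" using assms by auto
  show ?thesis unfolding empty using True by simp
next
  case False
  then have c: "c > 0" using assms by simp
  define a where "a = t / c"
  have a: "a > 0" using c assms by (simp add: a_def)
  have eq: "{y. 0 < y \<and> t \<le> y * c} = {a..}"
    using c a less_le_trans[OF a] unfolding a_def by (auto simp: pos_divide_le_eq)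
  have "emeasure pareto_measure {a..} =
      (\<integral>\<^sup>+y. ennreal (indicator {0<..} y / y\<^sup>2) * indicator {a..} y \<partial>lborel)"
    unfolding pareto_measure_def by (subst emeasure_density) auto
  also have "\<dots> = (\<integral>\<^sup>+y. ennreal (1 / y\<^sup>2) * indicator {a..} y \<partial>lborel)"
    using a by (intro nn_integral_cong) (auto simp: indicator_def)
  also have "\<dots> = ennreal (0 - (- (1 / a)))"
  proof (rule nn_integral_FTC_atLeast)
    show "((\<lambda>x. - (1 / x)) \<longlongrightarrow> 0) (at_top :: real filter)"
      by real_asymp
    show "((\<lambda>x. - (1 / x)) has_real_derivative 1 / x\<^sup>2) (at x)" if "a \<le> x" for x
      using that a by (auto intro!: derivative_eq_intros simp: power2_eq_square)
  qed auto
  finally show ?thesis using eq by (simp add: a_def)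
qed

text \<open>The measure lives on the axes. By homogeneity \<open>g\<close> is linear along each
  half-axis, so axis \<open>k\<close> contributes one Pareto half-line of mass
  \<open>g (axis k 1) / t\<close>.\<close>

lemma emeasure_indep_exponent_measure_superlevel:
  fixes g :: "real ^ 'k::finite \<Rightarrow> real"
  assumes g: "orthant_functional g" and t: "t > 0"
  shows "{z \<in> nonneg_orthant - {0}. t \<le> g z} \<in> sets borel"
    and "emeasure indep_exponent_measure {z \<in> nonneg_orthant - {0}. t \<le> g z} =
      ennreal (axis_sum g / t)"
proof -
  let ?B = "{z \<in> nonneg_orthant - {0}. t \<le> g z}"
  note [measurable] = orthant_functionalD(5)[OF g]
  have eqB: "?B = {z. (\<forall>k. 0 \<le> z $ k) \<and> t \<le> g z}"
    \<comment> \<open>Deleting the origin changes nothing, because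
      \<open>g 0 = 0 < t\<close>.\<close>
    using t orthant_functionalD(3)[OF g] by (auto simp: nonneg_orthant_def)
  have "{z :: real ^ 'k. (\<forall>k. 0 \<le> z $ k) \<and> t \<le> g z} \<in> sets borel"
    by measurable
  then show B: "?B \<in> sets borel" using eqB by simp
  have ax: "emeasure (axis_measure k) ?B = ennreal (g (axis k 1) / t)" for k
  proof -
    have pos: "0 \<le> g (axis k 1)"
      by (intro orthant_functionalD(4)[OF g] axis_in_nonneg_orthant) simp
    have scale: "g (axis k y) = y * g (axis k 1)" if "y \<ge> 0" for y
    proof -
      have "axis k y = y *\<^sub>R (axis k 1 :: real ^ 'k)" by (simp add: axis_def vec_eq_iff)
      then show ?thesis using orthant_functionalD(2)[OF g that] by simp
    qed
    have "axis k y \<in> ?B \<longleftrightarrow> 0 < y \<and> t \<le> y * g (axis k 1)" for y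
    proof -
      have "(\<forall>l. 0 \<le> (axis k y :: real ^ 'k) $ l) \<longleftrightarrow> 0 \<le> y" by (simp add: axis_def)
      then have "axis k y \<in> ?B \<longleftrightarrow> 0 \<le> y \<and> t \<le> g (axis k y)"
        unfolding eqB by simp
      also have "\<dots> \<longleftrightarrow> 0 < y \<and> t \<le> y * g (axis k 1)"
      proof (cases "0 < y")
        case True
        then show ?thesis using scale[of y] by simp
      next
        case False
        moreover have "\<not> t \<le> g (axis k 0)" using scale[of 0] t by simp
        ultimately show ?thesis by (cases "y = 0") simp_all
      qed
      finally show ?thesis .
    qed
    then have "axis k -` ?B = {y. 0 < y \<and> t \<le> y * g (axis k 1)}" by blast
    moreover have "emeasure (axis_measure k) ?B = emeasure pareto_measure (axis k -` ?B)"
      unfolding axis_measure_def using B measurable_axis[of k]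
      by (subst emeasure_distr) (auto simp: pareto_measure_def)
    ultimately show ?thesis using emeasure_pareto_measure_superlevel[OF t pos] by simp
  qed
  have "emeasure indep_exponent_measure ?B = (\<Sum>k\<in>UNIV. ennreal (g (axis k 1) / t))"
    by (simp only: emeasure_indep_exponent_measure[OF B] ax)
  also have "\<dots> = ennreal (\<Sum>k\<in>UNIV. g (axis k 1) / t)"
    using t by (intro sum_ennreal divide_nonneg_pos orthant_functionalD(4)[OF g]
      axis_in_nonneg_orthant) auto
  finally show "emeasure indep_exponent_measure ?B = ennreal (axis_sum g / t)"
    by (simp add: axis_sum_def sum_divide_distrib)
qed

section \<open>Tails of a regularly varying vector\<close>

text \<open>Vague convergence only controls continuous test functions, not indicators. The integrals
  \<open>J n\<close> of a ramp between the levels \<open>s\<close> and \<open>t\<close> converge and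
  separate the masses of the two superlevel sets.\<close>

lemma vague_conv_superlevel:
  fixes g :: "real ^ 'k::finite \<Rightarrow> real"
  assumes g: "orthant_functional g" and st: "0 < s" "s < t"
    and conv: "vague_conv_away_from_zero nonneg_orthant \<mu> indep_exponent_measure"
    and sets: "\<And>n. sets (\<mu> n) = sets borel"
  obtains J j where "J \<longlonglongrightarrow> j" "ennreal (axis_sum g / t) \<le> j" "j \<le> ennreal (axis_sum g / s)"
    "\<And>n. emeasure (\<mu> n) {z \<in> nonneg_orthant - {0}. t \<le> g z} \<le> J n"
    "\<And>n. J n \<le> emeasure (\<mu> n) {z \<in> nonneg_orthant - {0}. s < g z}"
proof -
  note gD = orthant_functionalD[OF g]
  note [measurable] = gD(5)
  \<comment> \<open>The ramp \<open>f\<close> lies between the indicators of \<open>{t \<le> g}\<close> and \<open>{s < g}\<close>.\<close>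
  define f where "f z = min 1 (max 0 ((g z - s) / (t - s)))" for z
  let ?S = "nonneg_orthant - {0} :: (real ^ 'k) set"
  define I where "I \<mu> = (\<integral>\<^sup>+z\<in>?S. ennreal (f z) \<partial>\<mu>)" for \<mu>
  have "{z :: real ^ 'k. (\<forall>k. 0 \<le> z $ k) \<and> s < g z} \<in> sets borel" by measurable
  moreover have "{z :: real ^ 'k. (\<forall>k. 0 \<le> z $ k) \<and> s < g z} = {z \<in> ?S. s < g z}"
    using st gD(3) by (auto simp: nonneg_orthant_def)
  ultimately have Bs: "{z \<in> ?S. s < g z} \<in> sets borel" by simp
  have Bt: "{z \<in> ?S. t \<le> g z} \<in> sets borel"
    using emeasure_indep_exponent_measure_superlevel(1)[OF g, of t] st by simp
  have lower: "emeasure \<mu> {z \<in> ?S. t \<le> g z} \<le> I \<mu>" if "sets \<mu> = sets borel" for \<mu>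
  proof -
    have "emeasure \<mu> {z \<in> ?S. t \<le> g z} = (\<integral>\<^sup>+z. indicator {z \<in> ?S. t \<le> g z} z \<partial>\<mu>)"
      using Bt that by simp
    also have "\<dots> \<le> I \<mu>" unfolding I_def
      using st by (intro nn_integral_mono) (auto simp: indicator_def f_def)
    finally show ?thesis .
  qed
  have upper: "I \<mu> \<le> emeasure \<mu> {z \<in> ?S. s < g z}" if "sets \<mu> = sets borel" for \<mu>
  proof -
    have "I \<mu> \<le> (\<integral>\<^sup>+z. indicator {z \<in> ?S. s < g z} z \<partial>\<mu>)" unfolding I_def
      using st by (intro nn_integral_mono) (auto simp: indicator_def f_def divide_le_0_iff)
    also have "\<dots> = emeasure \<mu> {z \<in> ?S. s < g z}"
      using Bs that by simp
    finally show ?thesis .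
  qed
  have "continuous_on ?S f" unfolding f_def
    using st by (intro continuous_intros continuous_on_subset[OF gD(1)]) auto
  moreover have "bounded (f ` ?S)"
    by (rule boundedI[of _ 1]) (auto simp: f_def)
  \<comment> \<open>A test function must vanish near the origin: as \<open>g 0 = 0\<close>,
    continuity keeps \<open>g\<close> below \<open>s\<close> on a ball, and there the ramp is
    0.\<close>
  moreover obtain r where r: "r > 0" "\<And>z. dist z 0 < r \<Longrightarrow> dist (g z) (g 0) < s"
    using gD(1) st unfolding continuous_on_iff by (metis UNIV_I)
  have "f z = 0" if "norm z < r" for z
  proof -
    have "(g z - s) / (t - s) \<le> 0"
      using r(2)[of z] that st gD(3) by (intro divide_nonpos_pos) (auto simp: dist_norm)
    then show ?thesis by (simp add: f_def)
  qed
  then have "\<exists>r>0. \<forall>z\<in>?S. norm z < r \<longrightarrow> f z = 0" using r(1) by blast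
  ultimately have "(\<lambda>n. I (\<mu> n)) \<longlonglongrightarrow> I indep_exponent_measure"
    using conv unfolding vague_conv_away_from_zero_def I_def
    by (elim allE[of _ f]) (auto simp: f_def)
  moreover have "ennreal (axis_sum g / t) \<le> I indep_exponent_measure"
    using lower[of indep_exponent_measure] st
      emeasure_indep_exponent_measure_superlevel(2)[OF g, of t] by simp
  moreover have "I indep_exponent_measure \<le> ennreal (axis_sum g / s)"
  proof -
    have "emeasure indep_exponent_measure {z \<in> ?S. s < g z} \<le>
      emeasure indep_exponent_measure {z \<in> ?S. s \<le> g z}"
      using emeasure_indep_exponent_measure_superlevel(1)[OF g, of s] st
      by (intro emeasure_mono) auto
    then show ?thesis
      using upper[of indep_exponent_measure] st
        emeasure_indep_exponent_measure_superlevel(2)[OF g, of s] by simp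
  qed
  ultimately show ?thesis using that lower upper sets by blast
qed

text \<open>Ramps between \<open>t\<close> and a nearby level \<open>u\<close> on either side bound
  the scaled tail; letting \<open>u\<close> approach \<open>t\<close> closes the gap since
  \<open>axis_sum g / u\<close> is continuous in \<open>u\<close>. A single sequence
  \<open>c\<close> serves all \<open>g\<close> and \<open>t\<close>, so that different functionals
  can be compared later.\<close>

lemma (in prob_space) reg_var_indep_tail_sequence:
  fixes Z :: "'a \<Rightarrow> real ^ 'k::finite"
  assumes Z[measurable]: "Z \<in> borel_measurable M" and nonneg: "AE \<omega> in M. Z \<omega> \<in> nonneg_orthant"
    and rv: "reg_var_indep M Z"
  shows "\<exists>c :: nat \<Rightarrow> real. (\<forall>n. 0 < c n) \<and> (\<forall>g t. orthant_functional g \<longrightarrow> 0 < t \<longrightarrow>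
    (\<lambda>n. n * prob {\<omega> \<in> space M. t * c n < g (Z \<omega>)}) \<longlonglongrightarrow> axis_sum g / t)"
proof -
  define \<mu> where "\<mu> c n =
    scale_measure (of_nat n) (distr M borel (\<lambda>\<omega>. inverse (c n) *\<^sub>R Z \<omega>))" for c :: "nat \<Rightarrow> real" and n
  obtain c where c: "\<And>n. 0 < c n"
    and conv: "vague_conv_away_from_zero nonneg_orthant (\<mu> c) indep_exponent_measure"
    using rv unfolding reg_var_indep_def \<mu>_def by blast
  have "(\<lambda>n. n * prob {\<omega> \<in> space M. t * c n < g (Z \<omega>)}) \<longlonglongrightarrow> axis_sum g / t"
    if g: "orthant_functional g" and t: "0 < t" for g t
  proof -
    note gD = orthant_functionalD[OF g]
    note [measurable] = gD(5)
    define p where "p t n = real n * prob {\<omega> \<in> space M. t * c n < g (Z \<omega>)}" for t n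
    have sets: "sets (\<mu> c n) = sets borel" for n by (simp add: \<mu>_def)
    have \<mu>: "emeasure (\<mu> c n) B = ennreal (n * prob {\<omega> \<in> space M. inverse (c n) *\<^sub>R Z \<omega> \<in> B})"
      if "B \<in> sets borel" for B n
      using that unfolding \<mu>_def
      by (simp add: emeasure_distr emeasure_eq_measure ennreal_mult ennreal_of_nat_eq_real_of_nat
        vimage_def Int_def conj_commute)
    have ev: "s * c n < g (Z \<omega>) \<longleftrightarrow> s < g (inverse (c n) *\<^sub>R Z \<omega>)"  for s n \<omega>
    proof -
      have "g (inverse (c n) *\<^sub>R Z \<omega>) = g (Z \<omega>) / c n"
        using c[of n] gD(2)[of "inverse (c n)" "Z \<omega>"] by (simp add: divide_inverse mult.commute)
      then show ?thesis using c[of n] by (simp add: pos_less_divide_eq)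
    qed
    have hi: "emeasure (\<mu> c n) {z \<in> nonneg_orthant - {0}. s < g z} \<le> ennreal (p s n)"
      if "s > 0" for s n
    proof -
      have "emeasure (\<mu> c n) {z \<in> nonneg_orthant - {0}. s < g z} \<le>
        emeasure (\<mu> c n) {z. s < g z}"
        by (intro emeasure_mono) (auto simp: sets)
      also have "\<dots> = ennreal (p s n)"
        by (subst \<mu>) (auto simp: p_def ev)
      finally show ?thesis .
    qed
    \<comment> \<open>This direction has to place \<open>Z\<close> in the orthant, which holds up to
      a null set; the bound \<open>hi\<close> merely drops that constraint.\<close>
    have lo: "ennreal (p s n) \<le> emeasure (\<mu> c n) {z \<in> nonneg_orthant - {0}. s \<le> g z}"
      if s: "s > 0" for s n
    proof -
      note B = emeasure_indep_exponent_measure_superlevel(1)[OF g s]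
      have "prob {\<omega> \<in> space M. s * c n < g (Z \<omega>)} \<le>
        prob {\<omega> \<in> space M. inverse (c n) *\<^sub>R Z \<omega> \<in> {z \<in> nonneg_orthant - {0}. s \<le> g z}}"
      proof (rule finite_measure_mono_AE)
        have "{\<omega> \<in> space M. inverse (c n) *\<^sub>R Z \<omega> \<in> B} \<in> events" if "B \<in> sets borel" for B
          using measurable_sets[OF borel_measurable_scaleR[OF borel_measurable_const Z] that]
          by (simp add: vimage_def Int_def conj_commute)
        from this[OF B] show "{\<omega> \<in> space M. inverse (c n) *\<^sub>R Z \<omega> \<in>
          {z \<in> nonneg_orthant - {0}. s \<le> g z}} \<in> events" .
        show "AE \<omega> in M. \<omega> \<in> {\<omega> \<in> space M. s * c n < g (Z \<omega>)} \<longrightarrow>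
          \<omega> \<in> {\<omega> \<in> space M. inverse (c n) *\<^sub>R Z \<omega> \<in> {z \<in> nonneg_orthant - {0}. s \<le> g z}}"
          using nonneg
        proof eventually_elim
          case (elim \<omega>)
          then have "inverse (c n) *\<^sub>R Z \<omega> \<in> nonneg_orthant"
            using c[of n] by (auto simp: nonneg_orthant_def)
          then show ?case using ev[of s n \<omega>] gD(3) s by auto
        qed
      qed
      then show ?thesis
        by (subst \<mu>[OF B]) (auto simp: p_def intro!: ennreal_leI mult_left_mono)
    qed
    have "p t \<longlonglongrightarrow> axis_sum g / t"
    proof (rule order_tendstoI)
      fix a assume a: "a < axis_sum g / t"
      show "eventually (\<lambda>n. a < p t n) sequentially"
      \<comment> \<open>The limit from the ramps is taken in \<open>ennreal\<close>, where a
        negative \<open>a\<close> would be truncated to 0.\<close>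
      proof (cases "a < 0")
        case True
        then have "a < p t n" for n by (auto simp: p_def intro: less_le_trans)
        then show ?thesis by simp
      next
        case False
        have "((\<lambda>u. axis_sum g / u) \<longlongrightarrow> axis_sum g / t) (at_right t)"
          using t by (intro tendsto_intros) auto
        from order_tendstoD(1)[OF this a]
        have "eventually (\<lambda>u. a < axis_sum g / u \<and> t < u) (at_right t)"
          by (simp add: eventually_conj_iff eventually_at_right_less)
        then obtain u where u: "a < axis_sum g / u" "t < u"
          using eventually_happens'[OF trivial_limit_at_right_real] by blast
        obtain J j where J: "J \<longlonglongrightarrow> j" "ennreal (axis_sum g / u) \<le> j" "j \<le> ennreal (axis_sum g / t)"
          "\<And>n. emeasure (\<mu> c n) {z \<in> nonneg_orthant - {0}. u \<le> g z} \<le> J n"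
          "\<And>n. J n \<le> emeasure (\<mu> c n) {z \<in> nonneg_orthant - {0}. t < g z}"
          by (rule vague_conv_superlevel[OF g t u(2) conv sets]) blast
        have "ennreal a < j"
          using J(2) u False by (intro less_le_trans[OF _ J(2)]) (simp add: ennreal_less_iff)
        from order_tendstoD(1)[OF J(1) this] show ?thesis
        proof eventually_elim
          case (elim n)
          then have "ennreal a < ennreal (p t n)"
            using J(5)[of n] hi[OF t, of n] by (meson less_le_trans)
          then show ?case using False by (simp add: ennreal_less_iff)
        qed
      qed
    next
      fix a assume a: "axis_sum g / t < a"
      have "((\<lambda>u. axis_sum g / u) \<longlongrightarrow> axis_sum g / t) (at_left t)"
        using t by (intro tendsto_intros) auto
      from order_tendstoD(2)[OF this a]
      have "eventually (\<lambda>u. axis_sum g / u < a \<and> u \<in> {0<..<t}) (at_left t)"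
        using eventually_at_left_real[OF t] by eventually_elim auto
      then obtain u where u: "axis_sum g / u < a" "0 < u" "u < t"
        using eventually_happens'[OF trivial_limit_at_left_real] by fastforce
      obtain J j where J: "J \<longlonglongrightarrow> j" "ennreal (axis_sum g / t) \<le> j" "j \<le> ennreal (axis_sum g / u)"
        "\<And>n. emeasure (\<mu> c n) {z \<in> nonneg_orthant - {0}. t \<le> g z} \<le> J n"
        "\<And>n. J n \<le> emeasure (\<mu> c n) {z \<in> nonneg_orthant - {0}. u < g z}"
        by (rule vague_conv_superlevel[OF g u(2,3) conv sets]) blast
      have "j < ennreal a"
        using u axis_sum_nonneg[OF g] by (intro le_less_trans[OF J(3)]) (simp add: ennreal_less_iff)
      from order_tendstoD(2)[OF J(1) this]
      show "eventually (\<lambda>n. p t n < a) sequentially"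
      proof eventually_elim
        case (elim n)
        then have "ennreal (p t n) < ennreal a"
          using J(4)[of n] lo[OF t, of n] by (meson le_less_trans)
        then show ?case by (simp add: ennreal_less_iff p_def)
      qed
    qed
    then show ?thesis unfolding p_def .
  qed
  with c show ?thesis by (intro exI[of _ c] conjI allI impI)
qed

section \<open>From the scaling sequence to real thresholds\<close>

lemma (in prob_space) prob_gt_tendsto_0:
  fixes Y :: "'a \<Rightarrow> real"
  assumes [measurable]: "Y \<in> borel_measurable M"
  shows "((\<lambda>x. prob {\<omega> \<in> space M. x < Y \<omega>}) \<longlongrightarrow> 0) at_top"
proof -
  interpret D: real_distribution "distr M borel Y"
    by (rule real_distribution_distr) simp
  have "((\<lambda>x. 1 - cdf (distr M borel Y) x) \<longlongrightarrow> 1 - 1) at_top"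
    by (intro tendsto_intros D.cdf_lim_at_top_prob)
  moreover have "1 - cdf (distr M borel Y) x = prob {\<omega> \<in> space M. x < Y \<omega>}" for x
  proof -
    have "cdf (distr M borel Y) x = prob {\<omega> \<in> space M. Y \<omega> \<le> x}"
      unfolding cdf_def by (subst measure_distr) (auto simp: vimage_def Int_def conj_commute)
    moreover have "prob {\<omega> \<in> space M. \<not> Y \<omega> \<le> x} = 1 - prob {\<omega> \<in> space M. Y \<omega> \<le> x}"
      by (rule prob_neg) simp
    ultimately show ?thesis by (simp add: not_le)
  qed
  ultimately show ?thesis by simp
qed

text \<open>Normalising by the tail of the norm removes the sequence \<open>c\<close>. The divisor
  \<open>CARD('k)\<close> is the value of \<open>axis_sum\<close> at the norm.\<close>

lemma (in prob_space) reg_var_indep_tail_ratio: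
  fixes Z :: "'a \<Rightarrow> real ^ 'k::finite"
  assumes Z[measurable]: "Z \<in> borel_measurable M" and nonneg: "AE \<omega> in M. Z \<omega> \<in> nonneg_orthant"
    and rv: "reg_var_indep M Z"
  defines "U \<equiv> \<lambda>x. prob {\<omega> \<in> space M. x < norm (Z \<omega>)}"
  shows "\<And>x. 0 < x \<Longrightarrow> 0 < U x"
    and "\<And>g. orthant_functional g \<Longrightarrow>
      ((\<lambda>x. prob {\<omega> \<in> space M. x < g (Z \<omega>)} / U x) \<longlongrightarrow> axis_sum g / CARD('k)) at_top"
proof -
  define K where "K = real CARD('k)"
  have K: "K > 0" by (simp add: K_def)
  obtain c :: "nat \<Rightarrow> real" where c: "\<And>n. 0 < c n"
    and lim: "\<And>g t. orthant_functional g \<Longrightarrow> 0 < t \<Longrightarrow>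
       (\<lambda>n. n * prob {\<omega> \<in> space M. t * c n < g (Z \<omega>)}) \<longlonglongrightarrow> axis_sum g / t"
    using reg_var_indep_tail_sequence[OF Z nonneg rv] by blast
  have limU: "(\<lambda>n. n * U (t * c n)) \<longlonglongrightarrow> K / t" if "t > 0" for t
    using lim[OF orthant_functional_norm that] by (simp add: U_def axis_sum_norm K_def)
  have U_mono: "U y \<le> U x" if "x \<le> y" for x y
    unfolding U_def using that by (intro finite_measure_mono) auto
  have U_nonneg: "0 \<le> U x" for x by (simp add: U_def)
  have U_ev: "eventually (\<lambda>n. 0 < U (t * c n)) sequentially" if "t > 0" for t
  proof -
    have "K / t > 0" using K that by simp
    from order_tendstoD(1)[OF limU[OF that] this] show ?thesis
      by eventually_elim (auto simp: zero_less_mult_iff)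
  qed
  \<comment> \<open>If \<open>U x = 0\<close>, then eventually \<open>c n < x\<close>, as
    \<open>U (c n) > 0\<close> eventually. For \<open>t = s / x\<close> this gives
    \<open>U s \<le> U (t * c n)\<close>, which is of order \<open>1 / n\<close>; hence
    \<open>U\<close> vanishes at every positive \<open>s\<close>, a contradiction.\<close>
  show U_pos: "0 < U x" if x: "0 < x" for x
  proof (rule ccontr)
    assume "\<not> 0 < U x"
    with U_nonneg[of x] have Ux: "U x = 0" by simp
    have bd: "eventually (\<lambda>n. c n < x) sequentially"
      using U_ev[of 1]
    proof (rule eventually_mono)
      show "c n < x" if "0 < U (1 * c n)" for n
        using U_mono[of x "c n"] Ux that by (cases "c n < x") auto
    qed simp
    have "U s = 0" if s: "s > 0" for s
    proof -
      define t where "t = s / x"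
      have t: "t > 0" using s x by (simp add: t_def)
      have "(\<lambda>n. inverse (real n) * (n * U (t * c n))) \<longlonglongrightarrow> 0 * (K / t)"
        by (intro tendsto_mult limU[OF t] LIMSEQ_inverse_real_of_nat[THEN LIMSEQ_imp_Suc])
      moreover have "eventually (\<lambda>n. U s \<le> inverse (real n) * (n * U (t * c n))) sequentially"
        using bd eventually_gt_at_top[of 0]
      proof eventually_elim
        case (elim n)
        have "t * c n \<le> t * x" using elim t by simp
        also have "t * x = s" using x by (simp add: t_def)
        finally show ?case using U_mono[of "t * c n" s] elim by (simp add: field_simps)
      qed
      ultimately have "U s \<le> 0 * (K / t)"
        by (intro tendsto_lowerbound) auto
      then show ?thesis using U_nonneg[of s] by simp
    qed
    with c have "\<not> 0 < U (1 * c n)" for n by simp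
    then show False using U_ev[of 1] by simp
  qed
  \<comment> \<open>Choosing \<open>n = N x\<close> with \<open>N x * U x \<longrightarrow> 1\<close> makes \<open>x\<close> asymptotically equal to \<open>K * c n\<close>, which
    extends the limits along the sequence \<open>c\<close> to all real \<open>x\<close>.\<close>
  define N where "N x = nat \<lceil>1 / U x\<rceil>" for x
  have U0: "(U \<longlongrightarrow> 0) at_top"
    unfolding U_def by (rule prob_gt_tendsto_0) simp
  have Upos_ev: "eventually (\<lambda>x. U x > 0) at_top"
    using eventually_gt_at_top[of 0] by eventually_elim (rule U_pos)
  have invU: "filterlim (\<lambda>x. 1 / U x) at_top at_top"
    using filterlim_inverse_at_top[OF U0 Upos_ev] by (simp add: divide_inverse)
  have N_ge: "1 / U x \<le> real (N x)" for x unfolding N_def by linarith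
  have N_le: "real (N x) \<le> 1 / U x + 1" for x
    using U_nonneg[of x] unfolding N_def by (smt (verit) divide_nonneg_nonneg of_int_ceiling_le_add_one of_nat_nat zero_le_ceiling)
  have "filterlim (\<lambda>x. real (N x)) at_top at_top"
    by (rule filterlim_at_top_mono[OF invU]) (simp add: N_ge)
  then have N_lim: "filterlim N sequentially at_top"
    by (simp add: filterlim_sequentially_iff_filterlim_real)
  have NU: "((\<lambda>x. N x * U x) \<longlongrightarrow> 1) at_top"
  proof (rule tendsto_sandwich)
    show "eventually (\<lambda>x. 1 \<le> N x * U x) at_top"
      using Upos_ev
    proof eventually_elim
      case (elim x)
      then show ?case using N_ge[of x] by (simp add: field_simps)
    qed
    show "eventually (\<lambda>x. N x * U x \<le> 1 + U x) at_top"
      using Upos_ev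
    proof eventually_elim
      case (elim x)
      then have "N x * U x \<le> (1 / U x + 1) * U x"
        by (intro mult_right_mono N_le) simp
      also have "\<dots> = 1 + U x" using elim by (simp add: distrib_right)
      finally show ?case .
    qed
    show "((\<lambda>x. 1 + U x) \<longlongrightarrow> 1) at_top" using tendsto_add[OF tendsto_const[of 1] U0] by simp
  qed simp
  have scaled: "((\<lambda>x. N x * U (t * K * c (N x))) \<longlongrightarrow> 1 / t) at_top" if "t > 0" for t
    using filterlim_compose[OF limU[of "t * K"] N_lim] K that by simp
  \<comment> \<open>As \<open>U\<close> is decreasing, comparing its values orders the arguments:
    \<open>N x * U x\<close> tends to 1, but at the argument \<open>t * K * c (N x)\<close> the
    limit is \<open>1 / t\<close>. The bound \<open>below\<close> is symmetric.\<close>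
  have above: "eventually (\<lambda>x. x < t * K * c (N x)) at_top" if t: "1 < t" for t
  proof -
    have "((\<lambda>x. N x * U x - N x * U (t * K * c (N x))) \<longlongrightarrow> 1 - 1 / t) at_top"
      using t by (intro tendsto_diff NU scaled) auto
    from order_tendstoD(1)[OF this, of 0] t
    have "eventually (\<lambda>x. 0 < N x * U x - N x * U (t * K * c (N x))) at_top" by simp
    then show ?thesis
    proof eventually_elim
      case (elim x)
      then have "0 < N x * (U x - U (t * K * c (N x)))" by (simp add: algebra_simps)
      then have "U (t * K * c (N x)) < U x" by (simp add: zero_less_mult_iff)
      then show ?case using U_mono by (meson not_le)
    qed
  qed
  have below: "eventually (\<lambda>x. t * K * c (N x) < x) at_top" if t: "0 < t" "t < 1" for t
  proof -
    have "((\<lambda>x. N x * U (t * K * c (N x)) - N x * U x) \<longlongrightarrow> 1 / t - 1) at_top"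
      using t by (intro tendsto_diff NU scaled) auto
    from order_tendstoD(1)[OF this, of 0] t
    have "eventually (\<lambda>x. 0 < N x * U (t * K * c (N x)) - N x * U x) at_top" by simp
    then show ?thesis
    proof eventually_elim
      case (elim x)
      then have "0 < N x * (U (t * K * c (N x)) - U x)" by (simp add: algebra_simps)
      then have "U x < U (t * K * c (N x))" by (simp add: zero_less_mult_iff)
      then show ?case using U_mono by (meson not_le)
    qed
  qed
  fix g :: "real ^ 'k \<Rightarrow> real"
  assume g: "orthant_functional g"
  note [measurable] = orthant_functionalD(5)[OF g]
  define P where "P x = prob {\<omega> \<in> space M. x < g (Z \<omega>)}" for x
  define L where "L = axis_sum g / K"
  have P_mono: "P y \<le> P x" if "x \<le> y" for x y
    unfolding P_def using that by (intro finite_measure_mono) auto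
  have P_scaled: "((\<lambda>x. N x * P (t * K * c (N x))) \<longlongrightarrow> L / t) at_top" if "t > 0" for t
    using filterlim_compose[OF lim[OF g, of "t * K"] N_lim] K that
    by (simp add: P_def L_def field_simps)
  have lim_inv: "((\<lambda>u. L / u) \<longlongrightarrow> L) (at (1::real) within S)" for S
    using tendsto_divide[OF tendsto_const tendsto_ident_at, where b = 1] by simp
  \<comment> \<open>For \<open>u\<close> on either side of 1 the points
    \<open>u * K * c (N x)\<close> enclose \<open>x\<close>. Monotonicity of \<open>P\<close> then
    squeezes \<open>N x * P x\<close> between values with limits \<open>L / u\<close>, and
    \<open>u\<close> may be taken arbitrarily close to 1.\<close>
  have "((\<lambda>x. N x * P x) \<longlongrightarrow> L) at_top"
  proof (rule order_tendstoI)
    fix a assume a: "a < L"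
    have "eventually (\<lambda>u. a < L / u \<and> 1 < u) (at_right 1)"
      using order_tendstoD(1)[OF lim_inv a] by (simp add: eventually_conj_iff eventually_at_right_less)
    then obtain u where u: "a < L / u" "1 < u"
      using eventually_happens'[OF trivial_limit_at_right_real] by blast
    have "eventually (\<lambda>x. a < N x * P (u * K * c (N x))) at_top"
      using order_tendstoD(1)[OF P_scaled u(1)] u(2) by simp
    with above[OF u(2)] show "eventually (\<lambda>x. a < N x * P x) at_top"
    proof eventually_elim
      case (elim x)
      then show ?case
        using mult_left_mono[OF P_mono[of x "u * K * c (N x)"], of "real (N x)"] by simp
    qed
  next
    fix a assume a: "L < a"
    have "eventually (\<lambda>u. L / u < a \<and> u \<in> {0<..<1}) (at_left 1)"
      using order_tendstoD(2)[OF lim_inv a] eventually_at_left_real[of 0 1]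
      by (simp add: eventually_conj_iff)
    then obtain u where u: "L / u < a" "0 < u" "u < 1"
      using eventually_happens'[OF trivial_limit_at_left_real] by fastforce
    have "eventually (\<lambda>x. N x * P (u * K * c (N x)) < a) at_top"
      using order_tendstoD(2)[OF P_scaled u(1)] u(2) by simp
    with below[OF u(2,3)] show "eventually (\<lambda>x. N x * P x < a) at_top"
    proof eventually_elim
      case (elim x)
      then show ?case
        using mult_left_mono[OF P_mono[of "u * K * c (N x)" x], of "real (N x)"] by simp
    qed
  qed
  then have "((\<lambda>x. (N x * P x) / (N x * U x)) \<longlongrightarrow> L / 1) at_top"
    by (intro tendsto_divide NU) auto
  moreover have "eventually (\<lambda>x. (N x * P x) / (N x * U x) = P x / U x) at_top"
    using Upos_ev
  proof eventually_elim
    case (elim x)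
    then have "0 < N x" using N_ge[of x] by (smt (verit) divide_pos_pos of_nat_0_less_iff)
    then show ?case by simp
  qed
  ultimately have "((\<lambda>x. P x / U x) \<longlongrightarrow> L / 1) at_top"
    by (rule Lim_transform_eventually)
  then show "((\<lambda>x. prob {\<omega> \<in> space M. x < g (Z \<omega>)} / U x) \<longlongrightarrow> axis_sum g / CARD('k)) at_top"
    by (simp add: P_def L_def K_def)
qed

section \<open>Extremal correlations of the factor model\<close>

context linear_factor_model
begin

definition Z_tail :: "real \<Rightarrow> real" where
  "Z_tail x = prob {\<omega> \<in> space M. x < norm (Z \<omega>)}"

lemma Z_tail_pos: "0 < x \<Longrightarrow> 0 < Z_tail x"
  unfolding Z_tail_def
  by (rule reg_var_indep_tail_ratio(1)[OF Z_measurable Z_nonneg Z_reg_var])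

text \<open>The factor \<open>t\<close> is absorbed into the functional:
  \<open>inverse t * g\<close> is again an orthant functional.\<close>

lemma functional_tail_ratio:
  assumes g: "orthant_functional g" and t: "0 < t"
  shows "((\<lambda>x. prob {\<omega> \<in> space M. t * x < g (Z \<omega>)} / Z_tail x)
    \<longlongrightarrow> axis_sum g / CARD('k) / t) at_top"
proof -
  have "((\<lambda>x. prob {\<omega> \<in> space M. x < inverse t * g (Z \<omega>)} / Z_tail x)
      \<longlongrightarrow> axis_sum (\<lambda>z. inverse t * g z) / CARD('k)) at_top"
    using t unfolding Z_tail_def
    by (intro reg_var_indep_tail_ratio(2)[OF Z_measurable Z_nonneg Z_reg_var]
        orthant_functional_scale g) auto
  moreover have "x < inverse t * y \<longleftrightarrow> t * x < y" for x y
    using t by (simp add: field_simps)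
  ultimately show ?thesis by (simp only: axis_sum_scale) (simp add: divide_inverse mult_ac)
qed

text \<open>The model compares the tails of \<open>E\<close> and \<open>Z\<close> at one threshold.
  Regular variation of the norm of \<open>Z\<close> replaces \<open>Z_tail (\<delta> * x)\<close> by
  \<open>Z_tail x\<close> at the cost of a constant factor.\<close>

lemma noise_tail_ratio:
  assumes \<delta>: "0 < \<delta>"
  shows "((\<lambda>x. prob {\<omega> \<in> space M. \<delta> * x < norm (E \<omega>)} / Z_tail x) \<longlongrightarrow> 0) at_top"
proof -
  have "filterlim (\<lambda>x. \<delta> * x) at_top at_top"
    using \<delta> by (intro filterlim_tendsto_pos_mult_at_top[OF tendsto_const _ filterlim_ident])
  from filterlim_compose[OF E_lighter_tail this]
  have "((\<lambda>x. prob {\<omega> \<in> space M. \<delta> * x < norm (E \<omega>)} / Z_tail (\<delta> * x)) \<longlongrightarrow> 0) at_top"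
    by (simp add: Z_tail_def)
  from tendsto_mult[OF this functional_tail_ratio[OF orthant_functional_norm \<delta>]]
  have "((\<lambda>x. (prob {\<omega> \<in> space M. \<delta> * x < norm (E \<omega>)} / Z_tail (\<delta> * x)) *
    (Z_tail (\<delta> * x) / Z_tail x)) \<longlongrightarrow> 0) at_top"
    by (simp add: Z_tail_def)
  moreover have "eventually (\<lambda>x. (prob {\<omega> \<in> space M. \<delta> * x < norm (E \<omega>)} / Z_tail (\<delta> * x)) *
    (Z_tail (\<delta> * x) / Z_tail x) = prob {\<omega> \<in> space M. \<delta> * x < norm (E \<omega>)} / Z_tail x) at_top"
    using eventually_gt_at_top[of 0]
  proof eventually_elim
    case (elim x)
    then show ?case using Z_tail_pos[of "\<delta> * x"] \<delta> by simp
  qed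
  ultimately show ?thesis by (rule Lim_transform_eventually)
qed

text \<open>If \<open>g (Z \<omega>)\<close> exceeds \<open>t * x\<close> with \<open>t > 1\<close>,
  then \<open>Y\<close> exceeds \<open>x\<close> unless the noise exceeds
  \<open>(t - 1) * x\<close>; for \<open>t < 1\<close> the roles of \<open>Y\<close> and
  \<open>g (Z \<omega>)\<close> are exchanged. The noise events are negligible, and \<open>t\<close>
  tends to 1.\<close>

lemma perturbed_tail_ratio:
  assumes g: "orthant_functional g" and [measurable]: "Y \<in> borel_measurable M"
    and Y: "\<And>\<omega>. \<omega> \<in> space M \<Longrightarrow> \<bar>Y \<omega> - g (Z \<omega>)\<bar> \<le> norm (E \<omega>)"
  shows "((\<lambda>x. prob {\<omega> \<in> space M. x < Y \<omega>} / Z_tail x) \<longlongrightarrow> axis_sum g / CARD('k)) at_top"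
proof -
  note [measurable] = orthant_functionalD(5)[OF g] Z_measurable E_measurable
  define L where "L = axis_sum g / CARD('k)"
  define P where "P t x = prob {\<omega> \<in> space M. t * x < g (Z \<omega>)}" for t x
  define Q where "Q \<delta> x = prob {\<omega> \<in> space M. \<delta> * x < norm (E \<omega>)}" for \<delta> x
  define R where "R x = prob {\<omega> \<in> space M. x < Y \<omega>}" for x
  have P: "((\<lambda>x. P t x / Z_tail x) \<longlongrightarrow> L / t) at_top" if "0 < t" for t
    using functional_tail_ratio[OF g that] by (simp add: P_def L_def)
  have Q: "((\<lambda>x. Q \<delta> x / Z_tail x) \<longlongrightarrow> 0) at_top" if "0 < \<delta>" for \<delta>
    using noise_tail_ratio[OF that] by (simp add: Q_def)
  have P_le: "P t x \<le> R x + Q (t - 1) x" for t x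
  proof -
    have "P t x \<le> prob ({\<omega> \<in> space M. x < Y \<omega>} \<union> {\<omega> \<in> space M. (t - 1) * x < norm (E \<omega>)})"
      unfolding P_def using Y by (intro finite_measure_mono) (force simp: algebra_simps abs_le_iff)+
    also have "\<dots> \<le> R x + Q (t - 1) x"
      unfolding R_def Q_def by (intro measure_Un_le) auto
    finally show ?thesis .
  qed
  have R_le: "R x \<le> P t x + Q (1 - t) x" for t x
  proof -
    have "R x \<le> prob ({\<omega> \<in> space M. t * x < g (Z \<omega>)} \<union> {\<omega> \<in> space M. (1 - t) * x < norm (E \<omega>)})"
      unfolding R_def using Y by (intro finite_measure_mono) (force simp: algebra_simps abs_le_iff)+
    also have "\<dots> \<le> P t x + Q (1 - t) x"
      unfolding P_def Q_def by (intro measure_Un_le) auto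
    finally show ?thesis .
  qed
  have lim_inv: "((\<lambda>u. L / u) \<longlongrightarrow> L) (at (1::real) within S)" for S
    using tendsto_divide[OF tendsto_const tendsto_ident_at, where b = 1] by simp
  have "((\<lambda>x. R x / Z_tail x) \<longlongrightarrow> L) at_top"
  proof (rule order_tendstoI)
    fix a assume a: "a < L"
    have "eventually (\<lambda>u. a < L / u \<and> 1 < u) (at_right 1)"
      using order_tendstoD(1)[OF lim_inv a] by (simp add: eventually_conj_iff eventually_at_right_less)
    then obtain u where u: "a < L / u" "1 < u"
      using eventually_happens'[OF trivial_limit_at_right_real] by blast
    have "((\<lambda>x. P u x / Z_tail x - Q (u - 1) x / Z_tail x) \<longlongrightarrow> L / u - 0) at_top"
      using u by (intro tendsto_diff P Q) auto
    from order_tendstoD(1)[OF this, of a] u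
    have "eventually (\<lambda>x. a < P u x / Z_tail x - Q (u - 1) x / Z_tail x) at_top" by simp
    with eventually_gt_at_top[of 0] show "eventually (\<lambda>x. a < R x / Z_tail x) at_top"
    proof eventually_elim
      case (elim x)
      have "(P u x - Q (u - 1) x) / Z_tail x \<le> R x / Z_tail x"
        using P_le[of u x] Z_tail_pos[OF elim(1)] by (intro divide_right_mono) auto
      then show ?case using elim by (simp add: diff_divide_distrib)
    qed
  next
    fix a assume a: "L < a"
    have "eventually (\<lambda>u. L / u < a \<and> u \<in> {0<..<1}) (at_left 1)"
      using order_tendstoD(2)[OF lim_inv a] eventually_at_left_real[of 0 1]
      by (simp add: eventually_conj_iff)
    then obtain u where u: "L / u < a" "0 < u" "u < 1"
      using eventually_happens'[OF trivial_limit_at_left_real] by fastforce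
    have "((\<lambda>x. P u x / Z_tail x + Q (1 - u) x / Z_tail x) \<longlongrightarrow> L / u + 0) at_top"
      using u by (intro tendsto_add P Q) auto
    from order_tendstoD(2)[OF this, of a] u
    have "eventually (\<lambda>x. P u x / Z_tail x + Q (1 - u) x / Z_tail x < a) at_top" by simp
    with eventually_gt_at_top[of 0] show "eventually (\<lambda>x. R x / Z_tail x < a) at_top"
    proof eventually_elim
      case (elim x)
      have "R x / Z_tail x \<le> (P u x + Q (1 - u) x) / Z_tail x"
        using R_le[of x u] Z_tail_pos[OF elim(1)] by (intro divide_right_mono) auto
      then show ?case using elim by (simp add: add_divide_distrib)
    qed
  qed
  then show ?thesis by (simp add: R_def L_def)
qed

text \<open>Both coordinates exceed \<open>x\<close> iff their minimum does, and the noise moves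
  this minimum by at most \<open>norm (E \<omega>)\<close>. The case \<open>i = j\<close> yields the
  marginal tail.\<close>

lemma joint_exceedance_ratio:
  "((\<lambda>x. prob {\<omega> \<in> space M. x < X \<omega> $ i \<and> x < X \<omega> $ j} / Z_tail x)
     \<longlongrightarrow> (\<Sum>a\<in>UNIV. min (A $ i $ a) (A $ j $ a)) / CARD('k)) at_top"
proof -
  define g where "g z = min ((A *v z) $ i) ((A *v z) $ j)" for z
  have comp: "(A *v (r *\<^sub>R z)) $ l = r * (A *v z) $ l" for r z l
    by (simp add: matrix_vector_mult_def sum_distrib_left mult_ac)
  have "continuous_on UNIV (\<lambda>z. (A *v z) $ l)" for l
    unfolding matrix_vector_mult_def by (simp, intro continuous_intros)
  moreover have "0 \<le> (A *v z) $ l" if "z \<in> nonneg_orthant" for z l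
    using that A_nonneg
    by (auto simp: matrix_vector_mult_def nonneg_orthant_def intro!: sum_nonneg mult_nonneg_nonneg)
  ultimately have g: "orthant_functional g"
    unfolding orthant_functional_def g_def
    by (auto simp: comp min_mult_distrib_left intro!: continuous_intros)
  have "g (axis a 1) = min (A $ i $ a) (A $ j $ a)" for a
    by (simp add: g_def matrix_vector_mult_basis column_def)
  then have sum: "axis_sum g = (\<Sum>a\<in>UNIV. min (A $ i $ a) (A $ j $ a))"
    by (simp add: axis_sum_def)
  have X: "X \<omega> $ l = (A *v Z \<omega>) $ l + E \<omega> $ l" if "\<omega> \<in> space M" for \<omega> l
    using X_eq[OF that] by simp
  have meas: "(\<lambda>\<omega>. X \<omega> $ l) \<in> borel_measurable M" for l
  proof -
    note [measurable] = measurable_compose[OF Z_measurable borel_measurable_nth]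
      measurable_compose[OF E_measurable borel_measurable_nth]
    have "(\<lambda>\<omega>. (\<Sum>a\<in>UNIV. A $ l $ a * Z \<omega> $ a) + E \<omega> $ l) \<in> borel_measurable M"
      by measurable
    then have "(\<lambda>\<omega>. (A *v Z \<omega>) $ l + E \<omega> $ l) \<in> borel_measurable M"
      by (simp add: matrix_vector_mult_def)
    then show ?thesis using X by (subst measurable_cong) auto
  qed
  have "((\<lambda>x. prob {\<omega> \<in> space M. x < min (X \<omega> $ i) (X \<omega> $ j)} / Z_tail x)
      \<longlongrightarrow> axis_sum g / CARD('k)) at_top"
  proof (rule perturbed_tail_ratio[OF g])
    show "(\<lambda>\<omega>. min (X \<omega> $ i) (X \<omega> $ j)) \<in> borel_measurable M"
      using meas by simp
    show "\<bar>min (X \<omega> $ i) (X \<omega> $ j) - g (Z \<omega>)\<bar> \<le> norm (E \<omega>)" if "\<omega> \<in> space M" for \<omega>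
      using X[OF that, of i] X[OF that, of j]
        component_le_norm_cart[of "E \<omega>" i] component_le_norm_cart[of "E \<omega>" j]
      unfolding g_def min_def by (auto simp: abs_le_iff)
  qed
  then show ?thesis by (simp add: sum)
qed

text \<open>Numerator and denominator are both compared with \<open>Z_tail\<close>, which cancels;
  unit row sums make all marginal limits equal to \<open>1 / CARD('k)\<close>, in particular
  nonzero.\<close>

lemma extremal_corr_eq:
  assumes "\<And>j. (\<Sum>a\<in>UNIV. A $ j $ a) = 1"
  shows "extremal_corr M X $ i $ j = (\<Sum>a\<in>UNIV. min (A $ i $ a) (A $ j $ a))"
proof -
  let ?m = "\<Sum>a\<in>UNIV. min (A $ i $ a) (A $ j $ a)"
  have marginal: "((\<lambda>x. prob {\<omega> \<in> space M. x < X \<omega> $ j} / Z_tail x) \<longlongrightarrow> 1 / CARD('k)) at_top"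
    using joint_exceedance_ratio[of j j] assms[of j] by simp
  have "((\<lambda>x. (prob {\<omega> \<in> space M. x < X \<omega> $ i \<and> x < X \<omega> $ j} / Z_tail x) /
      (prob {\<omega> \<in> space M. x < X \<omega> $ j} / Z_tail x)) \<longlongrightarrow> (?m / CARD('k)) / (1 / CARD('k))) at_top"
    by (intro tendsto_divide marginal joint_exceedance_ratio) auto
  moreover have "eventually (\<lambda>x. (prob {\<omega> \<in> space M. x < X \<omega> $ i \<and> x < X \<omega> $ j} / Z_tail x) /
      (prob {\<omega> \<in> space M. x < X \<omega> $ j} / Z_tail x) =
      prob {\<omega> \<in> space M. x < X \<omega> $ i \<and> x < X \<omega> $ j} / prob {\<omega> \<in> space M. x < X \<omega> $ j}) at_top"
    using eventually_gt_at_top[of 0]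
  proof eventually_elim
    case (elim x)
    then show ?case using Z_tail_pos[of x] by simp
  qed
  ultimately have "((\<lambda>x. prob {\<omega> \<in> space M. x < X \<omega> $ i \<and> x < X \<omega> $ j} /
      prob {\<omega> \<in> space M. x < X \<omega> $ j}) \<longlongrightarrow> (?m / CARD('k)) / (1 / CARD('k))) at_top"
    by (rule Lim_transform_eventually)
  then show ?thesis
    unfolding extremal_corr_def by (simp add: tendsto_Lim)
qed

end

section \<open>Recovering the pure variables from pairwise minima\<close>

text \<open>Probability enters only through \<open>corr\<close>. Keeping \<X> as a separate
  parameter allows two loading matrices, even with different numbers of factors, to be interpreted
  over the same matrix.\<close>

locale stochastic_loading =
  fixes A :: "real ^ 'k::finite ^ 'd::finite" and \<X> :: "real ^ 'd ^ 'd"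
  assumes nonneg: "0 \<le> A $ j $ a"
    and row_sum: "(\<Sum>a\<in>UNIV. A $ j $ a) = 1"
    and pure_ex: "\<exists>j. j \<in> pure_vars_of A a"
    and corr: "\<X> $ i $ j = (\<Sum>a\<in>UNIV. min (A $ i $ a) (A $ j $ a))"
begin

lemma corr_eq_0_iff: "\<X> $ i $ j = 0 \<longleftrightarrow> (\<forall>a. A $ i $ a = 0 \<or> A $ j $ a = 0)"
proof -
  have "\<X> $ i $ j = 0 \<longleftrightarrow> (\<forall>a. min (A $ i $ a) (A $ j $ a) = 0)"
    unfolding corr by (subst sum_nonneg_eq_0_iff) (auto simp: nonneg)
  also have "\<dots> \<longleftrightarrow> (\<forall>a. A $ i $ a = 0 \<or> A $ j $ a = 0)"
    using nonneg by (metis min.absorb1 min.absorb2 min_def)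
  finally show ?thesis .
qed

text \<open>Each row dominates the entrywise minimum and has sum 1, so minima of total 1 leave no
  slack in either row.\<close>

lemma corr_eq_1_iff: "\<X> $ i $ j = 1 \<longleftrightarrow> A $ i = A $ j"
proof
  assume eq: "\<X> $ i $ j = 1"
  have zero: "(\<Sum>a\<in>UNIV. A $ l $ a - min (A $ i $ a) (A $ j $ a)) = 0" for l
    using eq row_sum[of l] by (simp add: corr sum_subtractf)
  have "A $ i $ a - min (A $ i $ a) (A $ j $ a) = 0" for a
    using zero[of i] by (subst (asm) sum_nonneg_eq_0_iff) auto
  moreover have "A $ j $ a - min (A $ i $ a) (A $ j $ a) = 0" for a
    using zero[of j] by (subst (asm) sum_nonneg_eq_0_iff) auto
  ultimately show "A $ i = A $ j" by (simp add: vec_eq_iff)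
next
  assume "A $ i = A $ j"
  then show "\<X> $ i $ j = 1" by (simp add: corr row_sum)
qed

text \<open>Being pure for \<open>a\<close> means having the unit vector of \<open>a\<close> as row,
  that is, the same row as \<open>i\<close>. This gives (b) and describes the blocks through
  \<X>.\<close>

lemma pure_vars_of_eq:
  assumes "i \<in> pure_vars_of A a"
  shows "pure_vars_of A a = {j. \<X> $ i $ j = 1}"
proof -
  have "j \<in> pure_vars_of A a \<longleftrightarrow> A $ i = A $ j" for j
    using assms unfolding pure_vars_of_def vec_eq_iff by (auto, metis)
  then show ?thesis by (auto simp: corr_eq_1_iff)
qed

section \<open>Cliques of the zero-correlation graph\<close>

abbreviation "G \<equiv> zero_corr_edges \<X>"

lemma clique_iff:
  "clique C G \<longleftrightarrow> (\<forall>i\<in>C. \<forall>j\<in>C. i \<noteq> j \<longrightarrow> (\<forall>a. A $ i $ a = 0 \<or> A $ j $ a = 0))"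
proof -
  have "\<X> $ i $ j = \<X> $ j $ i" for i j by (simp add: corr min.commute)
  then have "{i, j} \<in> G \<longleftrightarrow> i \<noteq> j \<and> \<X> $ i $ j = 0" for i j
    unfolding zero_corr_edges_def by (auto simp: doubleton_eq_iff)
  then show ?thesis unfolding clique_def by (auto simp: corr_eq_0_iff)
qed

text \<open>A selector of one support element per row is injective on cliques because their supports
  are disjoint; this embeds each clique into the set of factors.\<close>

lemma support_selector:
  obtains s where "\<And>j. A $ j $ s j \<noteq> 0" "\<And>C. clique C G \<Longrightarrow> inj_on s C"
proof -
  have "\<exists>a. A $ j $ a \<noteq> 0" for j
    using row_sum[of j] by (metis sum.neutral zero_neq_one)
  then obtain s where s: "\<And>j. A $ j $ s j \<noteq> 0" by metis
  moreover have "inj_on s C" if "clique C G" for C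
    using that s unfolding clique_iff inj_on_def by metis
  ultimately show ?thesis by (rule that)
qed

lemma card_clique_le: "clique C G \<Longrightarrow> card C \<le> CARD('k)"
  using support_selector by (metis card_inj_on_le finite_class.finite_UNIV subset_UNIV)

text \<open>Distinct unit vectors have disjoint supports, so the bound \<open>card_clique_le\<close>
  is attained.\<close>

lemma pure_representatives:
  assumes p: "\<And>a. p a \<in> pure_vars_of A a"
  shows "clique (range p) G" "card (range p) = CARD('k)"
proof -
  have val: "A $ p a $ b = (if b = a then 1 else 0)" for a b
    using p[of a] by (auto simp: pure_vars_of_def)
  then have "inj p" by (metis injI zero_neq_one)
  then show "card (range p) = CARD('k)" by (rule card_image)
  show "clique (range p) G" unfolding clique_iff by (auto simp: val)
qed

lemma maximum_clique_iff: "maximum_clique UNIV G C \<longleftrightarrow> clique C G \<and> card C = CARD('k)"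
proof -
  obtain p where "\<And>a. p a \<in> pure_vars_of A a" using pure_ex by metis
  from pure_representatives[OF this] show ?thesis
    unfolding maximum_clique_def using card_clique_le by (metis le_antisym subset_UNIV)
qed

text \<open>On a clique of full size the selector \<open>s\<close> is a bijection onto the factors.
  Any factor other than \<open>s j\<close> is then selected by another member, whose support is
  disjoint from that of \<open>j\<close>; so row \<open>j\<close> lives on \<open>s j\<close> alone,
  and its sum makes that entry 1.\<close>

lemma maximum_clique_pure:
  assumes "maximum_clique UNIV G C"
  obtains p where "bij_betw p UNIV C" "\<And>a. p a \<in> pure_vars_of A a"
proof -
  have C: "clique C G" "card C = CARD('k)" using assms by (auto simp: maximum_clique_iff)
  obtain s where s: "\<And>j. A $ j $ s j \<noteq> 0" "inj_on s C"
    using support_selector C(1) by metis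
  have "s ` C = UNIV"
    using card_image[OF s(2)] C(2) by (intro card_subset_eq) auto
  with s(2) have bij: "bij_betw s C UNIV" by (simp add: bij_betw_def)
  have pure: "j \<in> pure_vars_of A (s j)" if j: "j \<in> C" for j
  proof -
    have zero: "A $ j $ b = 0" if "b \<noteq> s j" for b
    proof -
      obtain j' where "j' \<in> C" "b = s j'" using \<open>s ` C = UNIV\<close> by (metis UNIV_I imageE)
      then show ?thesis using C(1) j that s(1) unfolding clique_iff by metis
    qed
    then have "(\<Sum>a\<in>UNIV. A $ j $ a) = A $ j $ s j"
      by (subst sum.remove[of _ "s j"]) auto
    then show ?thesis using zero row_sum[of j] by (simp add: pure_vars_of_def)
  qed
  show ?thesis
  proof
    show bij': "bij_betw (inv_into C s) UNIV C" by (rule bij_betw_inv_into[OF bij])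
    show "inv_into C s a \<in> pure_vars_of A a" for a
      using pure[of "inv_into C s a"] bij bij'
      by (metis UNIV_I bij_betw_apply bij_betw_inv_into_right)
  qed
qed

text \<open>The right-hand side mentions \<X> only, so the correlation matrix determines the pure
  variables.\<close>

lemma pure_vars_eq_Union: "pure_vars A = \<Union> {C. maximum_clique UNIV G C}"
proof (intro subset_antisym subsetI)
  fix i assume "i \<in> pure_vars A"
  then obtain a where i: "i \<in> pure_vars_of A a" by (auto simp: pure_vars_def)
  obtain p where "\<And>a. p a \<in> pure_vars_of A a" using pure_ex by metis
  \<comment> \<open>Exchanging the representative of \<open>a\<close> for \<open>i\<close> puts the
    given pure variable into a maximum clique.\<close>
  with i have "(p(a := i)) b \<in> pure_vars_of A b" for b by simp
  from pure_representatives[OF this] have "maximum_clique UNIV G (range (p(a := i)))"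
    by (simp add: maximum_clique_iff)
  moreover have "i \<in> range (p(a := i))" by (metis fun_upd_same rangeI)
  ultimately show "i \<in> \<Union> {C. maximum_clique UNIV G C}" by blast
next
  fix i assume "i \<in> \<Union> {C. maximum_clique UNIV G C}"
  then obtain C where C: "maximum_clique UNIV G C" "i \<in> C" by blast
  obtain p where "bij_betw p UNIV C" "\<And>a. p a \<in> pure_vars_of A a"
    using maximum_clique_pure[OF C(1)] by metis
  with C(2) show "i \<in> pure_vars A"
    by (auto simp: pure_vars_def bij_betw_def)
qed

text \<open>The range forgets the labels of the factors; what remains depends on \<X> and the pure
  variable set only.\<close>

lemma range_pure_vars_of: "range (pure_vars_of A) = (\<lambda>i. {j. \<X> $ i $ j = 1}) ` pure_vars A"
proof (intro subset_antisym subsetI)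
  fix B assume "B \<in> range (pure_vars_of A)"
  then obtain a where "B = pure_vars_of A a" by blast
  with pure_ex[of a] pure_vars_of_eq
  show "B \<in> (\<lambda>i. {j. \<X> $ i $ j = 1}) ` pure_vars A"
    by (auto simp: pure_vars_def)
next
  fix B assume "B \<in> (\<lambda>i. {j. \<X> $ i $ j = 1}) ` pure_vars A"
  then obtain i a where "i \<in> pure_vars_of A a" "B = {j. \<X> $ i $ j = 1}"
    by (auto simp: pure_vars_def)
  with pure_vars_of_eq show "B \<in> range (pure_vars_of A)" by blast
qed

end

section \<open>Transfer to the factor model\<close>

lemma stochastic_loading_extremal_corr:
  assumes "linear_factor_model M A Z E X"
    and "\<forall>j. (\<Sum>a\<in>UNIV. A $ j $ a) = 1"
    and "\<forall>a. \<exists>j. A $ j $ a = 1 \<and> (\<forall>b. b \<noteq> a \<longrightarrow> A $ j $ b = 0)"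
  shows "stochastic_loading A (extremal_corr M X)"
proof -
  interpret linear_factor_model M A Z E X by fact
  show ?thesis
    using assms A_nonneg extremal_corr_eq by unfold_locales (auto simp: pure_vars_of_def)
qed

theorem theorem2:
  fixes M :: "'w measure"
    and A :: "real ^ 'k::finite ^ 'd::finite"
    and Z :: "'w \<Rightarrow> real ^ 'k"
    and E X :: "'w \<Rightarrow> real ^ 'd"
  assumes model: "linear_factor_model M A Z E X"
    and row_sums: "\<forall>j. (\<Sum>a\<in>UNIV. A $ j $ a) = 1"
    and pure_ex: "\<forall>a. \<exists>j. A $ j $ a = 1 \<and> (\<forall>b. b \<noteq> a \<longrightarrow> A $ j $ b = 0)"
  shows
    "(\<forall>C. maximum_clique UNIV (zero_corr_edges (extremal_corr M X)) C \<longrightarrow>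
        (\<exists>i. bij_betw i (UNIV :: 'k set) C \<and> (\<forall>a. i a \<in> pure_vars_of A a)))
   \<and> (\<forall>a i. card (pure_vars_of A a) \<ge> 2 \<and> i \<in> pure_vars_of A a \<longrightarrow>
        (\<forall>j \<in> max_corr_set (extremal_corr M X) i.
           j \<in> pure_vars_of A a \<longleftrightarrow> extremal_corr M X $ i $ j = 1))
   \<and> (\<forall>(M' :: 'v measure) (A' :: real ^ 'l::finite ^ 'd) Z' E' X'.
        linear_factor_model M' A' Z' E' X' \<and>
        (\<forall>j. (\<Sum>a\<in>UNIV. A' $ j $ a) = 1) \<and>
        (\<forall>a. \<exists>j. A' $ j $ a = 1 \<and> (\<forall>b. b \<noteq> a \<longrightarrow> A' $ j $ b = 0)) \<and>
        extremal_corr M' X' = extremal_corr M X \<longrightarrow>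
        pure_vars A' = pure_vars A \<and> range (pure_vars_of A') = range (pure_vars_of A))"
proof (intro conjI allI impI)
  interpret stochastic_loading A "extremal_corr M X"
    using model row_sums pure_ex by (rule stochastic_loading_extremal_corr)
  fix C assume "maximum_clique UNIV (zero_corr_edges (extremal_corr M X)) C"
  then show "\<exists>i. bij_betw i (UNIV :: 'k set) C \<and> (\<forall>a. i a \<in> pure_vars_of A a)"
    using maximum_clique_pure by metis
next
  interpret stochastic_loading A "extremal_corr M X"
    using model row_sums pure_ex by (rule stochastic_loading_extremal_corr)
  fix a i assume "card (pure_vars_of A a) \<ge> 2 \<and> i \<in> pure_vars_of A a"
  then show "\<forall>j \<in> max_corr_set (extremal_corr M X) i.
      j \<in> pure_vars_of A a \<longleftrightarrow> extremal_corr M X $ i $ j = 1"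
    using pure_vars_of_eq by blast
next
  interpret stochastic_loading A "extremal_corr M X"
    using model row_sums pure_ex by (rule stochastic_loading_extremal_corr)
  fix M' :: "'v measure" and A' :: "real ^ 'l::finite ^ 'd" and Z' E' X'
  assume *: "linear_factor_model M' A' Z' E' X' \<and>
        (\<forall>j. (\<Sum>a\<in>UNIV. A' $ j $ a) = 1) \<and>
        (\<forall>a. \<exists>j. A' $ j $ a = 1 \<and> (\<forall>b. b \<noteq> a \<longrightarrow> A' $ j $ b = 0)) \<and>
        extremal_corr M' X' = extremal_corr M X"
  then have "stochastic_loading A' (extremal_corr M X)"
    using stochastic_loading_extremal_corr by metis
  \<comment> \<open>Both interpretations share the correlation matrix and hence the graph, so their
    pure variables are the same union of maximum cliques.\<close>
  then interpret A': stochastic_loading A' "extremal_corr M X" .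
  show eq: "pure_vars A' = pure_vars A"
    unfolding pure_vars_eq_Union A'.pure_vars_eq_Union ..
  show "range (pure_vars_of A') = range (pure_vars_of A)"
    unfolding range_pure_vars_of A'.range_pure_vars_of eq ..
qed

end
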